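(* There exist constants $c_1,c_2>0$ such that for every $n\ge 3$, the Cayley graph of the symmetric group $S_n$ with respect to the generating set $\{(12),(12\cdots n),(12\cdots n)^{-1}\}$ (vertex set $S_n$, with $\phi$ adjacent to $s\phi$ for each generator $s$) has Cheeger constant at most $c_1n^{-2}$ and spectral gap at least $c_2n^{-3}$.
   Context: For a finite graph $G=(V,E)$, the Laplacian is $\Delta f(x)=\sum_{y\sim x}(f(y)-f(x))$; the spectral gap is the least nonzero eigenvalue of $-\Delta$. The Cheeger constant is $h=\min_{0<|A|\le|V|/2}|\partial A|/|A|$, where $|\partial A|$ is the number of edges between $A$ and $V\setminus A$. *)

theory Defs
  imports Complex_Main "HOL-Algebra.Sym_Groups"
begin

text \<open>A graph is a vertex set \<open>V\<close> together with a set \<open>E\<close> of unordered pairs \<open>{x, y}\<close>.\<close>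

definition neighbours :: "'a set \<Rightarrow> 'a set set \<Rightarrow> 'a \<Rightarrow> 'a set" where
  "neighbours V E x = {y \<in> V. {x, y} \<in> E}"

definition laplacian :: "'a set \<Rightarrow> 'a set set \<Rightarrow> ('a \<Rightarrow> real) \<Rightarrow> 'a \<Rightarrow> real" where
  "laplacian V E f x = (\<Sum>y\<in>neighbours V E x. f y - f x)"

text \<open>Real-valued functions on \<open>V\<close> are represented by functions on the whole type,
  whose values outside \<open>V\<close> are irrelevant. Real eigenfunctions suffice because the operator
  is symmetric.\<close>

definition neg_laplacian_eigenvalue :: "'a set \<Rightarrow> 'a set set \<Rightarrow> real \<Rightarrow> bool" where
  "neg_laplacian_eigenvalue V E l \<longleftrightarrow>
     (\<exists>f. (\<exists>x\<in>V. f x \<noteq> 0) \<and> (\<forall>x\<in>V. - laplacian V E f x = l * f x))"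

definition spectral_gap :: "'a set \<Rightarrow> 'a set set \<Rightarrow> real" where
  "spectral_gap V E = Min {l. neg_laplacian_eigenvalue V E l \<and> l \<noteq> 0}"

definition edge_boundary :: "'a set \<Rightarrow> 'a set set \<Rightarrow> 'a set \<Rightarrow> 'a set set" where
  "edge_boundary V E A = {e \<in> E. \<exists>x\<in>A. \<exists>y\<in>V - A. e = {x, y}}"

definition cheeger_constant :: "'a set \<Rightarrow> 'a set set \<Rightarrow> real" where
  "cheeger_constant V E =
     Min ((\<lambda>A. real (card (edge_boundary V E A)) / real (card A)) `
       {A. A \<subseteq> V \<and> 0 < card A \<and> real (card A) \<le> real (card V) / 2})"

definition cayley_edges :: "('a, 'b) monoid_scheme \<Rightarrow> 'a set \<Rightarrow> 'a set set" where
  "cayley_edges G S = {{x, s \<otimes>\<^bsub>G\<^esub> x} | x s. x \<in> carrier G \<and> s \<in> S}"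

definition long_cycle :: "nat \<Rightarrow> nat \<Rightarrow> nat" where
  "long_cycle n = cycle_of_list [1..<Suc n]"

definition sym_generators :: "nat \<Rightarrow> (nat \<Rightarrow> nat) set" where
  "sym_generators n =
     {transpose 1 2, long_cycle n, inv\<^bsub>sym_group n\<^esub> (long_cycle n)}"

end

theory Submission
  imports Defs "HOL-Analysis.L2_Norm" "HOL-Analysis.Convex"
begin

text \<open>
  Spectral gap. For an eigenfunction \<open>f\<close> with eigenvalue \<open>l \<noteq> 0\<close>, which has mean zero, let
  \<open>N g\<close> be the \<open>\<ell>\<^sup>2\<close> norm of \<open>x \<mapsto> f (g x) - f x\<close>. Then \<open>(N s)\<^sup>2 \<le> 2 l \<parallel>f\<parallel>\<^sup>2\<close> for every generator \<open>s\<close>.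
  Every transposition is a word of length \<open>O(n)\<close> in the generators, and \<open>N\<close> is subadditive, so
  \<open>(N t)\<^sup>2 \<le> C n\<^sup>2 l \<parallel>f\<parallel>\<^sup>2\<close> for every transposition \<open>t\<close>. On the other hand, let \<open>Q\<^sub>k\<close> be the average
  over the subgroup \<open>S\<^sub>k\<close>. As \<open>Q\<^sub>0 f = f\<close> and \<open>Q\<^sub>n f = 0\<close>, \<open>\<parallel>f\<parallel>\<^sup>2\<close> is the sum of the
  orthogonal increments \<open>\<parallel>Q\<^sub>k\<^sub>-\<^sub>1 f - Q\<^sub>k f\<parallel>\<^sup>2\<close>, and since \<open>S\<^sub>k\<close> is the disjoint union of the cosets
  \<open>(k r) S\<^sub>k\<^sub>-\<^sub>1\<close> with \<open>r \<le> k\<close>, the \<open>k\<close>-th increment is at most the mean over \<open>r\<close> of \<open>(N (k r))\<^sup>2\<close>.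
  Together \<open>\<parallel>f\<parallel>\<^sup>2 \<le> C n\<^sup>3 l \<parallel>f\<parallel>\<^sup>2\<close>.

  Cheeger constant. View \<open>\<phi> i\<close> as the position of card \<open>i\<close> on a circle, and let \<open>A\<close> consist of those
  \<open>\<phi>\<close> for which card \<open>2\<close> is at most \<open>(n - 1) div 2\<close> steps ahead of card \<open>1\<close>. Rotations preserve \<open>A\<close>,
  and the transposition \<open>(1 2)\<close> leaves \<open>A\<close> from only three values of \<open>(\<phi> 1, \<phi> 2)\<close> out of
  order \<open>n\<^sup>2\<close>.
\<close>

section \<open>Averages over permutation subgroups\<close>

text \<open>On functions on the permutations of a finite superset of \<open>S\<close>, this is the
  orthogonal projection onto the functions constant on right cosets of the symmetric group of
  \<open>S\<close>, whose order is \<open>fact (card S)\<close>.\<close>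

definition perm_avg :: "'a set \<Rightarrow> (('a \<Rightarrow> 'a) \<Rightarrow> real) \<Rightarrow> ('a \<Rightarrow> 'a) \<Rightarrow> real" where
  "perm_avg S f x = (\<Sum>h | h permutes S. f (h \<circ> x)) / fact (card S)"

definition shift_energy :: "'a set \<Rightarrow> (('a \<Rightarrow> 'a) \<Rightarrow> real) \<Rightarrow> ('a \<Rightarrow> 'a) \<Rightarrow> real" where
  "shift_energy U f g = (\<Sum>x | x permutes U. (f (g \<circ> x) - f x)\<^sup>2)"

lemma square_mean_le:
  fixes a :: "'a \<Rightarrow> real"
  shows "((\<Sum>i\<in>I. a i) / card I)\<^sup>2 \<le> (\<Sum>i\<in>I. (a i)\<^sup>2) / card I"
proof (cases "card I = 0")
  case False
  then show ?thesis
    using sum_squared_le_sum_of_squares[of a I]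
    by (simp add: power_divide power2_eq_square field_simps)
qed simp

lemma sum_permutes_compose_left:
  assumes "g permutes U"
  shows "(\<Sum>x | x permutes U. F (g \<circ> x)) = (\<Sum>x | x permutes U. F x)"
  using setum_permutations_compose_left[OF assms, of F] by simp

lemma perm_avg_invariant:
  assumes "h permutes S"
  shows "perm_avg S f (h \<circ> x) = perm_avg S f x"
  using sum_permutations_compose_right[OF assms, of "\<lambda>p. f (p \<circ> x)"]
  by (simp add: perm_avg_def comp_assoc)

text \<open>Self-adjointness of averaging, against a \<open>g\<close> that averaging fixes: replace
  \<open>g x\<close> by \<open>g (h \<circ> x)\<close>, swap the sums and reindex the sum over
  \<open>x\<close> by left translation with \<open>h\<close>.\<close>

lemma sum_perm_avg_mult:
  assumes "finite U" "S \<subseteq> U" and inv: "\<And>h x. h permutes S \<Longrightarrow> g (h \<circ> x) = g x"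
  shows "(\<Sum>x | x permutes U. perm_avg S f x * g x) = (\<Sum>x | x permutes U. f x * g x)"
proof -
  have fS: "finite S" using assms finite_subset by blast
  have "(\<Sum>x | x permutes U. perm_avg S f x * g x)
      = (\<Sum>x | x permutes U. \<Sum>h | h permutes S. f (h \<circ> x) * g (h \<circ> x)) / fact (card S)"
    by (simp add: perm_avg_def sum_divide_distrib sum_distrib_right inv)
  also have "\<dots> = (\<Sum>h | h permutes S. \<Sum>x | x permutes U. f (h \<circ> x) * g (h \<circ> x)) / fact (card S)"
    by (subst sum.swap) simp
  also have "\<dots> = (\<Sum>h | h permutes S. \<Sum>x | x permutes U. f x * g x) / fact (card S)"
    using sum_permutes_compose_left[of _ U "\<lambda>y. f y * g y"] permutes_subset[OF _ assms(2)]
    by simp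
  also have "\<dots> = (\<Sum>x | x permutes U. f x * g x)"
    using card_permutations[OF refl fS] by simp
  finally show ?thesis .
qed

text \<open>The \<open>transpose a b\<close> represent the cosets of the symmetric group of
  \<open>S\<close> in that of \<open>insert a S\<close>, and the factorial splits
  accordingly.\<close>

lemma perm_avg_insert:
  assumes "finite S" "a \<notin> S"
  shows "perm_avg (insert a S) f x =
    perm_avg S (\<lambda>y. (\<Sum>b\<in>insert a S. f (transpose a b \<circ> y)) / card (insert a S)) x"
  unfolding perm_avg_def sum_over_permutations_insert[OF assms]
  using assms
  by (subst sum.swap) (simp add: comp_assoc sum_divide_distrib[symmetric] field_simps del: sum.insert)

text \<open>Jensen holds pointwise, and pairing with the constant 1 shows that averaging preserves
  the total of the squares.\<close>

lemma sum_perm_avg_square_le: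
  assumes "finite U" "S \<subseteq> U"
  shows "(\<Sum>x | x permutes U. (perm_avg S f x)\<^sup>2) \<le> (\<Sum>x | x permutes U. (f x)\<^sup>2)"
proof -
  have fS: "finite S" using assms finite_subset by blast
  have c: "real (card {h. h permutes S}) = fact (card S)"
    using card_permutations[OF refl fS] by simp
  have "(perm_avg S f x)\<^sup>2 \<le> perm_avg S (\<lambda>y. (f y)\<^sup>2) x" for x
    using square_mean_le[of "\<lambda>h. f (h \<circ> x)" "{h. h permutes S}"] by (simp add: perm_avg_def c)
  then have "(\<Sum>x | x permutes U. (perm_avg S f x)\<^sup>2)
      \<le> (\<Sum>x | x permutes U. perm_avg S (\<lambda>y. (f y)\<^sup>2) x * 1)"
    by (simp add: sum_mono)
  also have "\<dots> = (\<Sum>x | x permutes U. (f x)\<^sup>2)"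
    by (subst sum_perm_avg_mult[OF assms, of "\<lambda>_. 1"]) simp_all
  finally show ?thesis .
qed

text \<open>Pythagoras for the nested projections \<open>?P\<close> and \<open>?Q\<close>. Their
  difference is the \<open>S\<close>-average of \<open>g\<close>, itself a mean of transposition
  differences, so contraction and then Jensen over \<open>b\<close> give the bound.\<close>

lemma perm_avg_square_decrement:
  assumes U: "finite U" and sub: "insert a S \<subseteq> U" and a: "a \<notin> S"
  shows "(\<Sum>x | x permutes U. (perm_avg S f x)\<^sup>2) - (\<Sum>x | x permutes U. (perm_avg (insert a S) f x)\<^sup>2)
    \<le> (\<Sum>b\<in>insert a S. shift_energy U f (transpose a b)) / card (insert a S)"
proof -
  define K where "K = insert a S"
  have fS: "finite S" and SU: "S \<subseteq> U" and KU: "K \<subseteq> U" and fK: "finite K"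
    using U sub finite_subset by (auto simp: K_def)
  have K0: "real (card K) > 0" using fK by (auto simp: K_def card_gt_0_iff)
  let ?P = "perm_avg S f" and ?Q = "perm_avg K f"
  define g where "g y = (\<Sum>b\<in>K. f (transpose a b \<circ> y) - f y) / card K" for y
  have invS: "?Q (h \<circ> x) = ?Q x" if "h permutes S" for h x
    using that perm_avg_invariant[of h K] permutes_subset[of h S K] by (auto simp: K_def)
  \<comment> \<open>Both sides equal the inner product of \<open>f\<close> with \<open>?Q\<close>,
    since \<open>?Q\<close> is invariant under both groups.\<close>
  have PQ: "(\<Sum>x | x permutes U. ?P x * ?Q x) = (\<Sum>x | x permutes U. ?Q x * ?Q x)"
    using sum_perm_avg_mult[OF U SU invS, of f] sum_perm_avg_mult[OF U KU perm_avg_invariant[of _ K f], of f]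
    by simp
  have "g y = (\<Sum>b\<in>K. f (transpose a b \<circ> y)) / card K - f y" for y
    using K0 by (simp add: g_def sum_subtractf diff_divide_distrib)
  then have diff: "?Q x - ?P x = perm_avg S g x" for x
    unfolding perm_avg_insert[OF fS a, folded K_def]
    by (simp add: perm_avg_def sum_subtractf diff_divide_distrib)
  have "(\<Sum>x | x permutes U. (?P x)\<^sup>2) - (\<Sum>x | x permutes U. (?Q x)\<^sup>2)
      = (\<Sum>x | x permutes U. (?Q x - ?P x)\<^sup>2)"
    using PQ by (simp add: power2_eq_square algebra_simps sum.distrib sum_subtractf
        flip: sum_distrib_left)
  also have "\<dots> \<le> (\<Sum>x | x permutes U. (g x)\<^sup>2)"
    unfolding diff by (rule sum_perm_avg_square_le[OF U SU])
  also have "\<dots> \<le> (\<Sum>x | x permutes U. (\<Sum>b\<in>K. (f (transpose a b \<circ> x) - f x)\<^sup>2) / card K)"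
    unfolding g_def by (intro sum_mono square_mean_le)
  also have "\<dots> = (\<Sum>b\<in>K. shift_energy U f (transpose a b)) / card K"
    unfolding shift_energy_def sum_divide_distrib[symmetric] by (subst sum.swap) simp
  finally show ?thesis by (simp add: K_def)
qed

text \<open>Telescoping: points join \<open>S\<close> one at a time, starting from the trivial
  group, where the average is \<open>f\<close> itself. Each decrement is at most a mean of energies
  bounded by \<open>K\<close>.\<close>

lemma sum_square_le_perm_avg:
  fixes f :: "('a \<Rightarrow> 'a) \<Rightarrow> real" and K :: real
  assumes U: "finite U" and "S \<subseteq> U"
    and K: "\<And>a b. a \<in> U \<Longrightarrow> b \<in> U \<Longrightarrow> shift_energy U f (transpose a b) \<le> K"
  shows "(\<Sum>x | x permutes U. (f x)\<^sup>2) \<le> (\<Sum>x | x permutes U. (perm_avg S f x)\<^sup>2) + card S * K"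
proof -
  have "finite S" using assms finite_subset by blast
  then show ?thesis using \<open>S \<subseteq> U\<close>
  proof (induction S)
    case empty
    then show ?case by (simp add: perm_avg_def)
  next
    case (insert a S)
    have "(\<Sum>b\<in>insert a S. shift_energy U f (transpose a b)) \<le> card (insert a S) * K"
      using insert.prems K by (intro sum_bounded_above) auto
    then have "(\<Sum>b\<in>insert a S. shift_energy U f (transpose a b)) / card (insert a S) \<le> K"
      using insert.hyps by (simp add: field_simps)
    then show ?case
      using insert perm_avg_square_decrement[OF U insert.prems insert.hyps(2), of f]
      by (simp add: algebra_simps)
  qed
qed

lemma poincare_transpositions:
  fixes f :: "('a \<Rightarrow> 'a) \<Rightarrow> real" and K :: real
  assumes U: "finite U" and mean: "(\<Sum>x | x permutes U. f x) = 0"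
    and K: "\<And>a b. a \<in> U \<Longrightarrow> b \<in> U \<Longrightarrow> shift_energy U f (transpose a b) \<le> K"
  shows "(\<Sum>x | x permutes U. (f x)\<^sup>2) \<le> card U * K"
proof -
  have "perm_avg U f x = 0" if "x permutes U" for x
    using sum_permutations_compose_right[OF that, of f] mean by (simp add: perm_avg_def)
  then show ?thesis using sum_square_le_perm_avg[OF U order_refl K] by simp
qed

section \<open>The norm of a translation difference\<close>

text \<open>The square root of the energy, taken so that the triangle inequality bounds it by word
  length.\<close>

definition shift_norm :: "'a set \<Rightarrow> (('a \<Rightarrow> 'a) \<Rightarrow> real) \<Rightarrow> ('a \<Rightarrow> 'a) \<Rightarrow> real" where
  "shift_norm U f g = L2_set (\<lambda>x. f (g \<circ> x) - f x) {x. x permutes U}"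

lemma shift_energy_eq: "shift_energy U f g = (shift_norm U f g)\<^sup>2"
  by (simp add: shift_energy_def shift_norm_def L2_set_def sum_nonneg)

lemma shift_norm_id [simp]: "shift_norm U f id = 0"
  by (simp add: shift_norm_def L2_set_def)

lemma shift_norm_nonneg [simp]: "shift_norm U f g \<ge> 0"
  by (simp add: shift_norm_def)

text \<open>Insert the intermediate value at \<open>h \<circ> x\<close>; left translation by
  \<open>h\<close> then reindexes the first difference.\<close>

lemma shift_norm_comp:
  assumes h: "h permutes U"
  shows "shift_norm U f (g \<circ> h) \<le> shift_norm U f g + shift_norm U f h"
proof -
  have "shift_norm U f (g \<circ> h) =
     L2_set (\<lambda>x. (f (g \<circ> (h \<circ> x)) - f (h \<circ> x)) + (f (h \<circ> x) - f x)) {x. x permutes U}"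
    by (simp add: shift_norm_def comp_assoc)
  also have "\<dots> \<le> L2_set (\<lambda>x. f (g \<circ> (h \<circ> x)) - f (h \<circ> x)) {x. x permutes U} + shift_norm U f h"
    unfolding shift_norm_def by (rule L2_set_triangle_ineq)
  also have "L2_set (\<lambda>x. f (g \<circ> (h \<circ> x)) - f (h \<circ> x)) {x. x permutes U} = shift_norm U f g"
    using sum_permutes_compose_left[OF h, of "\<lambda>x. (f (g \<circ> x) - f x)\<^sup>2"]
    by (simp add: shift_norm_def L2_set_def)
  finally show ?thesis .
qed

lemma shift_norm_inv:
  assumes g: "g permutes U"
  shows "shift_norm U f (inv' g) = shift_norm U f g"
proof -
  have "inv' g \<circ> (g \<circ> x) = x" for x :: "'a \<Rightarrow> 'a"
    using permutes_inv_o(2)[OF g] by (simp add: o_assoc)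
  then show ?thesis
    using sum_permutes_compose_left[OF g, of "\<lambda>x. (f (inv' g \<circ> x) - f x)\<^sup>2"]
    by (simp add: shift_norm_def L2_set_def power2_commute)
qed

lemma shift_norm_funpow:
  assumes g: "g permutes U"
  shows "shift_norm U f (g ^^ k) \<le> k * shift_norm U f g"
proof (induction k)
  case (Suc k)
  then show ?case
    using shift_norm_comp[OF permutes_funpow[OF g], of f g k] by (simp add: algebra_simps del: o_apply)
qed (simp only: funpow.simps shift_norm_id of_nat_0 mult_zero_left order_refl)

lemma shift_norm_conj:
  assumes g: "g permutes U" and h: "h permutes U"
  shows "shift_norm U f (g \<circ> h \<circ> inv' g) \<le> 2 * shift_norm U f g + shift_norm U f h"
  using shift_norm_comp[OF permutes_inv[OF g], of f "g \<circ> h"] shift_norm_comp[OF h, of f g]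
  by (simp add: shift_norm_inv[OF g])

section \<open>Transpositions as words in the generators\<close>

lemma transpose_conj:
  assumes "g permutes U"
  shows "g \<circ> transpose a b \<circ> inv' g = transpose (g a) (g b)"
proof -
  have "g \<circ> transpose a b = transpose (g a) (g b) \<circ> g"
    using transpose_comp_eq[OF permutes_bij[OF assms], of "g a" "g b"]
    by (simp add: permutes_inverses[OF assms])
  then show ?thesis
    by (simp add: comp_assoc permutes_inv_o(1)[OF assms])
qed

lemma long_cycle_permutes: "long_cycle n permutes {1..n}"
  using cycle_permutes[of "[1..<Suc n]"] 
  by (simp add: long_cycle_def atLeastLessThanSuc_atLeastAtMost del: upt_Suc)

lemma long_cycle_apply:
  assumes "1 \<le> i" "i \<le> n"
  shows "long_cycle n i = (if i = n then 1 else i + 1)"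
proof -
  have "map (long_cycle n) [1..<Suc n] = rotate1 [1..<Suc n]"
    using cyclic_rotation[of "[1..<Suc n]" 1] by (simp add: long_cycle_def del: upt_Suc)
  then have "map (long_cycle n) [1..<Suc n] ! (i - 1) = rotate1 [1..<Suc n] ! (i - 1)" by simp
  then show ?thesis using assms
    by (auto simp: nth_rotate1 mod_if simp del: upt_Suc)
qed

lemma long_cycle_funpow:
  assumes "1 \<le> i" "i + k \<le> n"
  shows "(long_cycle n ^^ k) i = i + k"
  using assms by (induction k) (auto simp: long_cycle_apply)

text \<open>The word \<open>w\<close> is the cycle (2 3 ... n). Conjugating (1 2) by powers of
  \<open>w\<close> gives every transposition (1 j), and conjugating these by powers of the long
  cycle gives all others. Each conjugation costs twice the norm of the conjugating element.\<close>

lemma shift_norm_transpose_le: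
  fixes f :: "(nat \<Rightarrow> nat) \<Rightarrow> real"
  assumes n: "n \<ge> 2" and ab: "a \<in> {1..n}" "b \<in> {1..n}"
    and t: "shift_norm {1..n} f (transpose 1 2) \<le> d" and c: "shift_norm {1..n} f (long_cycle n) \<le> d"
  shows "shift_norm {1..n} f (transpose a b) \<le> 6 * n * d"
proof -
  define U where "U = {1..n}"
  let ?N = "shift_norm U f"
  define w where "w = transpose 1 2 \<circ> long_cycle n"
  have tp: "transpose 1 2 permutes U" using n by (auto simp: U_def intro: permutes_swap_id)
  have cp: "long_cycle n permutes U" using long_cycle_permutes by (simp add: U_def)
  have wp: "w permutes U" unfolding w_def by (rule permutes_compose[OF cp tp])
  have d: "d \<ge> 0" using t shift_norm_nonneg order_trans by blast
  have w: "?N w \<le> 2 * d"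
    using shift_norm_comp[OF cp, of f "transpose 1 2"] t c by (simp add: w_def U_def)
  have w1: "(w ^^ k) 1 = 1" for k
    using n by (induction k) (auto simp: w_def long_cycle_apply transpose_def)
  have w2: "(w ^^ k) 2 = k + 2" if "k + 2 \<le> n" for k
    using that by (induction k) (auto simp: w_def long_cycle_apply transpose_def)
  have one: "?N (transpose 1 (k + 2)) \<le> (4 * k + 1) * d" if "k + 2 \<le> n" for k
  proof -
    have "?N (transpose 1 (k + 2)) \<le> 2 * ?N (w ^^ k) + ?N (transpose 1 2)"
      using shift_norm_conj[OF permutes_funpow[OF wp, of k] tp, of f]
      by (simp only: transpose_conj[OF permutes_funpow[OF wp]] w1 w2[OF that])
    moreover have "?N (w ^^ k) \<le> k * (2 * d)"
      using shift_norm_funpow[OF wp, of f k] mult_left_mono[OF w, of "real k"] by simp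
    ultimately show ?thesis using t by (simp add: U_def algebra_simps)
  qed
  have less: "?N (transpose i j) \<le> 6 * n * d" if "1 \<le> i" "i < j" "j \<le> n" for i j
  proof -
    \<comment> \<open>Chosen so that \<open>m\<close> rotations carry the pair 1,
      \<open>k + 2\<close> to \<open>i\<close>, \<open>j\<close>.\<close>
    define m k where "m = i - 1" and "k = j - i - 1"
    have eq: "(long_cycle n ^^ m) 1 = i" "(long_cycle n ^^ m) (k + 2) = j"
      using that long_cycle_funpow[of 1 m n] long_cycle_funpow[of "k + 2" m n]
      by (auto simp: m_def k_def)
    have kn: "k + 2 \<le> n" "m + k + 2 \<le> n" using that by (auto simp: m_def k_def)
    have q: "transpose 1 (k + 2) permutes U"
      using kn by (auto simp: U_def intro: permutes_swap_id)
    have "?N (transpose i j) \<le> 2 * ?N (long_cycle n ^^ m) + ?N (transpose 1 (k + 2))"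
      using shift_norm_conj[OF permutes_funpow[OF cp, of m] q, of f]
      by (simp only: transpose_conj[OF permutes_funpow[OF cp]] eq)
    moreover have "?N (long_cycle n ^^ m) \<le> m * d"
      using shift_norm_funpow[OF cp, of f m] mult_left_mono[OF c, of "real m"]
      by (simp add: U_def)
    ultimately have "?N (transpose i j) \<le> (2 * m + 4 * k + 1) * d"
      using one[OF kn(1)] by (simp add: algebra_simps)
    \<comment> \<open>From \<open>m + k + 2 \<le> n\<close> the coefficient is at most 4n; the 6 is
      generous.\<close>
    also have "\<dots> \<le> 6 * n * d"
      using kn d by (intro mult_right_mono) auto
    finally show ?thesis .
  qed
  consider "a < b" | "b < a" | "a = b" by linarith
  then show ?thesis
  proof cases
    case 1 then show ?thesis using less[of a b] ab by (simp add: U_def)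
  next
    case 2 then show ?thesis using less[of b a] ab by (simp add: U_def transpose_commute)
  next
    case 3 then show ?thesis using d by simp
  qed
qed

section \<open>Eigenvalues of the Laplacian\<close>

text \<open>The adjacency weights \<open>w\<close> are symmetric, and the diagonal terms
  \<open>f x * g x\<close> occur on both sides and cancel.\<close>

lemma laplacian_symmetric:
  assumes "finite V"
  shows "(\<Sum>x\<in>V. laplacian V E f x * g x) = (\<Sum>x\<in>V. f x * laplacian V E g x)"
proof -
  define w where "w x y = (if {x, y} \<in> E then 1 else 0 :: real)" for x y
  have lap: "laplacian V E h x = (\<Sum>y\<in>V. w x y * (h y - h x))" for h x
    unfolding laplacian_def neighbours_def
    using assms by (simp add: w_def if_distrib[of "\<lambda>c. c * _"] sum.inter_filter cong: if_cong)
  have sym: "w x y = w y x" for x y by (simp add: w_def insert_commute)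
  have "(\<Sum>x\<in>V. laplacian V E f x * g x) - (\<Sum>x\<in>V. f x * laplacian V E g x)
      = (\<Sum>x\<in>V. \<Sum>y\<in>V. w x y * (f y * g x)) - (\<Sum>x\<in>V. \<Sum>y\<in>V. w x y * (f x * g y))"
    by (simp add: lap sum_distrib_left sum_distrib_right algebra_simps flip: sum_subtractf)
  also have "(\<Sum>x\<in>V. \<Sum>y\<in>V. w x y * (f x * g y)) = (\<Sum>x\<in>V. \<Sum>y\<in>V. w x y * (f y * g x))"
    by (subst sum.swap) (simp add: sym)
  finally show ?thesis by simp
qed

text \<open>Bessel's inequality for each point mass, summed over the points of \<open>V\<close>;
  each \<open>F l\<close> contributes its squared norm 1 to the total.\<close>

lemma orthonormal_card_le:
  fixes F :: "'i \<Rightarrow> 'a \<Rightarrow> real"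
  assumes V: "finite V" and L: "finite L"
    and orth: "\<And>l m. l \<in> L \<Longrightarrow> m \<in> L \<Longrightarrow> (\<Sum>x\<in>V. F l x * F m x) = (if l = m then 1 else 0)"
  shows "card L \<le> card V"
proof -
  have bessel: "(\<Sum>l\<in>L. (F l x)\<^sup>2) \<le> 1" if x: "x \<in> V" for x
  proof -
    \<comment> \<open>\<open>?d\<close> is the point mass at \<open>x\<close> and \<open>?p\<close>
      its projection onto the span of the \<open>F l\<close>.\<close>
    let ?p = "\<lambda>y. \<Sum>l\<in>L. F l x * F l y"
    let ?d = "\<lambda>y. if y = x then 1 else 0 :: real"
    have "(\<Sum>y\<in>V. ?p y * ?p y) = (\<Sum>y\<in>V. \<Sum>l\<in>L. \<Sum>m\<in>L. F l x * F m x * (F l y * F m y))"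
      by (simp add: sum_product mult_ac)
    also have "\<dots> = (\<Sum>l\<in>L. \<Sum>m\<in>L. F l x * F m x * (\<Sum>y\<in>V. F l y * F m y))"
      by (subst sum.swap, rule sum.cong[OF refl], subst sum.swap) (simp add: sum_distrib_left)
    also have "\<dots> = (\<Sum>l\<in>L. (F l x)\<^sup>2)"
      using L by (simp add: orth if_distrib[of "\<lambda>c. _ * c"] power2_eq_square cong: sum.cong if_cong)
    finally have pp: "(\<Sum>y\<in>V. ?p y * ?p y) = (\<Sum>l\<in>L. (F l x)\<^sup>2)" .
    have dd: "(\<Sum>y\<in>V. ?d y * ?d y) = 1"
      using V x by (simp add: if_distrib[of "\<lambda>c. _ * c"] cong: if_cong)
    have dp: "(\<Sum>y\<in>V. ?d y * ?p y) = (\<Sum>l\<in>L. (F l x)\<^sup>2)"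
      using V x by (simp add: if_distrib[of "\<lambda>c. c * _"] power2_eq_square cong: if_cong)
    have "0 \<le> (\<Sum>y\<in>V. (?d y - ?p y) * (?d y - ?p y))"
      by (intro sum_nonneg) simp
    also have "\<dots> = (\<Sum>y\<in>V. ?d y * ?d y - 2 * (?d y * ?p y) + ?p y * ?p y)"
      by (intro sum.cong refl) (simp only: ring_distribs left_diff_distrib right_diff_distrib, simp)
    also have "\<dots> = 1 - (\<Sum>l\<in>L. (F l x)\<^sup>2)"
      unfolding sum.distrib sum_subtractf sum_distrib_left[symmetric] pp dd dp by simp
    finally show ?thesis by simp
  qed
  have "real (card L) = (\<Sum>l\<in>L. \<Sum>x\<in>V. (F l x)\<^sup>2)"
    by (simp add: power2_eq_square orth)
  also have "\<dots> = (\<Sum>x\<in>V. \<Sum>l\<in>L. (F l x)\<^sup>2)"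
    by (rule sum.swap)
  also have "\<dots> \<le> (\<Sum>x\<in>V. 1)"
    by (intro sum_mono bessel)
  finally show ?thesis by simp
qed

text \<open>Finiteness lets \<open>Min\<close> in \<open>spectral_gap\<close> select an actual
  eigenvalue. Normalised eigenfunctions for distinct eigenvalues are orthonormal by symmetry, so
  there are at most \<open>card V\<close> of them.\<close>

lemma finite_neg_laplacian_eigenvalues:
  assumes V: "finite V"
  shows "finite {l. neg_laplacian_eigenvalue V E l}"
proof -
  have "\<exists>f. (\<Sum>x\<in>V. f x * f x) = 1 \<and> (\<forall>x\<in>V. - laplacian V E f x = l * f x)"
    if eig: "neg_laplacian_eigenvalue V E l" for l
  proof -
    obtain g z where z: "z \<in> V" "g z \<noteq> 0" and g: "\<And>x. x \<in> V \<Longrightarrow> - laplacian V E g x = l * g x"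
      using eig unfolding neg_laplacian_eigenvalue_def by blast
    define r where "r = sqrt (\<Sum>x\<in>V. g x * g x)"
    have pos: "(\<Sum>x\<in>V. g x * g x) > 0"
      using V z by (intro sum_pos2[of _ z]) (auto simp: zero_less_mult_iff linorder_neq_iff)
    have "(\<Sum>x\<in>V. (g x / r) * (g x / r)) = 1"
      using pos by (simp add: r_def flip: sum_divide_distrib)
    moreover have "- laplacian V E (\<lambda>x. g x / r) x = l * (g x / r)" if "x \<in> V" for x
    proof -
      have "laplacian V E (\<lambda>x. g x / r) x = laplacian V E g x / r"
        by (simp add: laplacian_def sum_divide_distrib diff_divide_distrib)
      then show ?thesis using g[OF that] by (simp add: minus_divide_left)
    qed
    ultimately show ?thesis by (intro exI[of _ "\<lambda>x. g x / r"]) blast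
  qed
  then obtain F where norm: "\<And>l. neg_laplacian_eigenvalue V E l \<Longrightarrow> (\<Sum>x\<in>V. F l x * F l x) = 1"
    and F: "\<And>l x. neg_laplacian_eigenvalue V E l \<Longrightarrow> x \<in> V \<Longrightarrow> - laplacian V E (F l) x = l * F l x"
    by metis
  have orth: "(\<Sum>x\<in>V. F l x * F m x) = 0"
    if l: "neg_laplacian_eigenvalue V E l" and m: "neg_laplacian_eigenvalue V E m" and "l \<noteq> m" for l m
  proof -
    have Fl: "laplacian V E (F l) x = - (l * F l x)" "laplacian V E (F m) x = - (m * F m x)" if "x \<in> V" for x
      using F[OF l that] F[OF m that] by linarith+
    have "l * (\<Sum>x\<in>V. F l x * F m x) = m * (\<Sum>x\<in>V. F l x * F m x)"
      using laplacian_symmetric[OF V, of E "F l" "F m"]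
      by (simp add: Fl sum_distrib_left sum_negf mult_ac cong: sum.cong)
    then show ?thesis using \<open>l \<noteq> m\<close> by simp
  qed
  have "card L \<le> card V" if "L \<subseteq> {l. neg_laplacian_eigenvalue V E l}" "finite L" for L
    using that norm orth by (intro orthonormal_card_le[OF V, of L F]) (auto simp: subset_iff)
  then show ?thesis
    using finite_if_finite_subsets_card_bdd by blast
qed

section \<open>Laplacians of Cayley graphs\<close>

lemma (in group) neighbours_cayley:
  assumes S: "S \<subseteq> carrier G" "\<And>s. s \<in> S \<Longrightarrow> inv s \<in> S" and x: "x \<in> carrier G"
  shows "neighbours (carrier G) (cayley_edges G S) x = (\<lambda>s. s \<otimes> x) ` S"
proof (intro equalityI subsetI)
  fix y assume "y \<in> neighbours (carrier G) (cayley_edges G S) x"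
  then obtain z s where zs: "z \<in> carrier G" "s \<in> S" "{x, y} = {z, s \<otimes> z}"
    unfolding neighbours_def cayley_edges_def by blast
  then consider "y = s \<otimes> x" | "x = s \<otimes> y" "y \<in> carrier G"
    by (auto simp: doubleton_eq_iff)
  then show "y \<in> (\<lambda>s. s \<otimes> x) ` S"
  proof cases
    \<comment> \<open>Edges are unordered, so \<open>x\<close> may be the end that was multiplied;
      closure of \<open>S\<close> under inverses covers this case.\<close>
    case 2
    then have "y = inv s \<otimes> x" using zs S(1) by (simp add: subset_iff flip: m_assoc)
    then show ?thesis using S(2) zs(2) by blast
  qed (use zs in blast)
next
  fix y assume "y \<in> (\<lambda>s. s \<otimes> x) ` S"
  then show "y \<in> neighbours (carrier G) (cayley_edges G S) x"
    using S(1) x unfolding neighbours_def cayley_edges_def by blast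
qed

lemma (in group) laplacian_cayley:
  assumes S: "S \<subseteq> carrier G" "\<And>s. s \<in> S \<Longrightarrow> inv s \<in> S" and x: "x \<in> carrier G"
  shows "laplacian (carrier G) (cayley_edges G S) f x = (\<Sum>s\<in>S. f (s \<otimes> x) - f x)"
proof -
  have "inj_on (\<lambda>s. s \<otimes> x) S"
    using S(1) x by (auto intro!: inj_onI simp: subset_iff)
  moreover have "neighbours (carrier G) (cayley_edges G S) x = (\<lambda>s. s \<otimes> x) ` S"
    by (rule neighbours_cayley) (use assms in auto)
  ultimately show ?thesis
    unfolding laplacian_def by (simp add: sum.reindex)
qed

section \<open>The spectral gap of the symmetric group\<close>

lemma carrier_sym_group: "carrier (sym_group n) = {p. p permutes {1..n}}"
  by (simp add: sym_group_def)

lemma finite_carrier_sym_group: "finite (carrier (sym_group n))"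
  by (simp add: carrier_sym_group finite_permutations)

lemma sym_generators_eq:
  "sym_generators n = {transpose 1 2, long_cycle n, inv' (long_cycle n)}"
  using long_cycle_permutes by (simp add: sym_generators_def sym_group_carrier)

lemma sym_generators_permutes:
  assumes "n \<ge> 2" "s \<in> sym_generators n"
  shows "s permutes {1..n}"
  using assms long_cycle_permutes[of n] permutes_inv[OF long_cycle_permutes, of n]
  by (auto simp: sym_generators_eq intro!: permutes_swap_id)

lemma laplacian_sym_group:
  assumes n: "n \<ge> 2" and x: "x permutes {1..n}"
  shows "laplacian (carrier (sym_group n)) (cayley_edges (sym_group n) (sym_generators n)) f x
    = (\<Sum>s\<in>sym_generators n. f (s \<circ> x) - f x)"
proof -
  interpret group "sym_group n" by (rule sym_group_is_group)
  have "sym_generators n \<subseteq> carrier (sym_group n)"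
    using sym_generators_permutes[OF n] by (auto simp: sym_group_carrier)
  moreover have "inv\<^bsub>sym_group n\<^esub> s \<in> sym_generators n" if s: "s \<in> sym_generators n" for s
  proof -
    have "inv\<^bsub>sym_group n\<^esub> s = inv' s"
      using sym_generators_permutes[OF n s] by (simp add: sym_group_carrier)
    then show ?thesis
      using s long_cycle_permutes[of n] by (auto simp: sym_generators_eq inv_inv_eq permutes_bij)
  qed
  ultimately show ?thesis
    using laplacian_cayley[of "sym_generators n" x f] x by (simp add: sym_group_carrier sym_group_mult)
qed

text \<open>The constant is 72 = 2 * 6^2: a generator has energy at most \<open>2 * (l * q)\<close>,
  and a transposition costs the factor \<open>6 * n\<close> in norm. The Poincare inequality
  supplies the third power of \<open>n\<close>.\<close>

lemma eigenvalue_sym_group_ge: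
  assumes n: "n \<ge> 2" and l: "l \<noteq> 0"
    and eig: "neg_laplacian_eigenvalue (carrier (sym_group n))
      (cayley_edges (sym_group n) (sym_generators n)) l"
  shows "l \<ge> 1 / 72 / real n ^ 3"
proof -
  define U S where "U = {1..n}" and "S = sym_generators n"
  obtain f z where z: "z permutes U" "f z \<noteq> 0"
    and "\<And>x. x permutes U \<Longrightarrow> - laplacian (carrier (sym_group n)) (cayley_edges (sym_group n) S) f x = l * f x"
    using eig unfolding neg_laplacian_eigenvalue_def U_def S_def by (auto simp: sym_group_carrier)
  then have f: "l * f x = (\<Sum>s\<in>S. f x - f (s \<circ> x))" if "x permutes U" for x
    using laplacian_sym_group[OF n, of x f] that 
    by (fastforce simp: U_def S_def simp flip: sum_negf)
  have SU: "s permutes U" if "s \<in> S" for s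
    using that sym_generators_permutes[OF n] by (simp add: U_def S_def)
  have fin: "finite {x. x permutes U}" "finite S"
    by (auto simp: U_def S_def sym_generators_eq finite_permutations)
  define q where "q = (\<Sum>x | x permutes U. (f x)\<^sup>2)"
  have q: "q > 0"
    unfolding q_def using z fin by (intro sum_pos2[of _ z]) auto
  \<comment> \<open>Sum the eigenvalue equation over the group: translation by each generator
    preserves the sum of \<open>f\<close>, so the right-hand side vanishes.\<close>
  have "l * (\<Sum>x | x permutes U. f x) = (\<Sum>x | x permutes U. \<Sum>s\<in>S. f x - f (s \<circ> x))"
    using f by (simp add: sum_distrib_left)
  also have "\<dots> = (\<Sum>s\<in>S. \<Sum>x | x permutes U. f x - f (s \<circ> x))"
    by (rule sum.swap)
  also have "\<dots> = 0"
    using SU sum_permutes_compose_left[of _ U f] by (intro sum.neutral) (simp add: sum_subtractf)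
  finally have mean: "(\<Sum>x | x permutes U. f x) = 0" using l by simp
  have energy: "(\<Sum>x | x permutes U. (f x - f (s \<circ> x)) * f x) = shift_energy U f s / 2" if "s \<in> S" for s
  proof -
    have "shift_energy U f s = (\<Sum>x | x permutes U. (f (s \<circ> x))\<^sup>2 + (f x)\<^sup>2 - 2 * (f (s \<circ> x) * f x))"
      by (simp add: shift_energy_def power2_diff mult_ac)
    also have "\<dots> = 2 * (\<Sum>x | x permutes U. (f x)\<^sup>2) - 2 * (\<Sum>x | x permutes U. f (s \<circ> x) * f x)"
      using sum_permutes_compose_left[OF SU[OF that], of "\<lambda>x. (f x)\<^sup>2"]
      by (simp add: sum.distrib sum_subtractf flip: sum_distrib_left)
    finally show ?thesis
      by (simp add: left_diff_distrib sum_subtractf power2_eq_square)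
  qed
  have "l * q = (\<Sum>x | x permutes U. \<Sum>s\<in>S. (f x - f (s \<circ> x)) * f x)"
    using f unfolding q_def sum_distrib_left sum_distrib_right[symmetric]
    by (intro sum.cong) (auto simp: power2_eq_square mult.assoc[symmetric])
  also have "\<dots> = (\<Sum>s\<in>S. shift_energy U f s / 2)"
    by (subst sum.swap) (simp add: energy)
  finally have lq: "l * q = (\<Sum>s\<in>S. shift_energy U f s / 2)" .
  \<comment> \<open>All summands of \<open>lq\<close> are nonnegative, so each is at most the
    total.\<close>
  have le: "shift_energy U f s \<le> 2 * (l * q)" if "s \<in> S" for s
    using member_le_sum[OF that, of "\<lambda>s. shift_energy U f s / 2"] fin
    by (simp add: lq shift_energy_def sum_nonneg)
  define d where "d = sqrt (2 * (l * q))"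
  have "shift_norm U f s \<le> d" if "s \<in> S" for s
    using le[OF that] unfolding d_def shift_energy_eq by (rule real_le_rsqrt)
  then have gens: "shift_norm U f (transpose 1 2) \<le> d" "shift_norm U f (long_cycle n) \<le> d"
    by (auto simp: S_def sym_generators_eq)
  have lq0: "l * q \<ge> 0"
    unfolding lq by (intro sum_nonneg) (simp add: shift_energy_eq)
  have "shift_energy U f (transpose a b) \<le> 72 * n\<^sup>2 * (l * q)" if "a \<in> U" "b \<in> U" for a b
  proof -
    have "shift_norm U f (transpose a b) \<le> 6 * real n * d"
      using shift_norm_transpose_le[OF n] gens that unfolding U_def by blast
    then have "shift_energy U f (transpose a b) \<le> (6 * real n * d)\<^sup>2"
      unfolding shift_energy_eq by (intro power_mono) auto
    then show ?thesis using lq0 by (simp add: d_def power_mult_distrib)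
  qed
  then have "q \<le> card U * (72 * n\<^sup>2 * (l * q))"
    unfolding q_def using mean by (intro poincare_transpositions) (auto simp: U_def)
  then have "1 * q \<le> (72 * real n ^ 3 * l) * q"
    by (simp add: U_def power2_eq_square power3_eq_cube mult_ac)
  then have "1 \<le> 72 * real n ^ 3 * l" using q by (simp only: mult_le_cancel_right_pos)
  then show ?thesis using n by (simp add: field_simps)
qed

lemma spectral_gap_sym_group_ge:
  assumes n: "n \<ge> 2"
  shows "spectral_gap (carrier (sym_group n)) (cayley_edges (sym_group n) (sym_generators n))
    \<ge> 1 / 72 / real n ^ 3"
proof -
  let ?V = "carrier (sym_group n)" and ?E = "cayley_edges (sym_group n) (sym_generators n)"
  define L where "L = {l. neg_laplacian_eigenvalue ?V ?E l \<and> l \<noteq> 0}"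
  have fin: "finite L"
    using finite_neg_laplacian_eigenvalues[OF finite_carrier_sym_group, of n ?E]
    by (simp add: L_def finite_subset[OF Collect_mono])
  \<comment> \<open>The sign character is an eigenfunction; this makes \<open>L\<close> nonempty, so that \<open>Min\<close> is meaningful.\<close>
  define l where "l = (\<Sum>s\<in>sym_generators n. 1 - real_of_int (sign s))"
  have "- laplacian ?V ?E (\<lambda>p. sign p) x = l * sign x" if x: "x permutes {1..n}" for x
  proof -
    have "sign (s \<circ> x) = sign s * sign x" if "s \<in> sym_generators n" for s
      using that x sym_generators_permutes[OF n]
      by (intro sign_compose) (auto simp: permutation_permutes)
    then show ?thesis
      by (simp add: laplacian_sym_group[OF n x] l_def sum_distrib_right left_diff_distrib flip: sum_negf)
  qed
  \<comment> \<open>The transposition contributes 2 and no summand is negative, hence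
    \<open>l \<ge> 2\<close>.\<close>
  moreover have "(1 - real_of_int (sign (transpose (1::nat) 2))) \<le> l"
    unfolding l_def by (rule member_le_sum) (auto simp: sym_generators_eq sign_def)
  then have "l \<noteq> 0" by (simp add: sign_swap_id)
  moreover have "\<exists>x\<in>?V. real_of_int (sign x) \<noteq> 0"
    by (rule bexI[of _ id]) (auto simp: sym_group_carrier permutes_id)
  ultimately have "l \<in> L"
    unfolding L_def neg_laplacian_eigenvalue_def
    by (intro CollectI conjI exI[of _ "\<lambda>p. real_of_int (sign p)"]) (auto simp: sym_group_carrier)
  then have "Min L \<in> L" using fin by (intro Min_in) auto
  then show ?thesis
    using eigenvalue_sym_group_ge[OF n] by (simp add: spectral_gap_def L_def)
qed

section \<open>The Cheeger constant\<close>

lemma card_permutes_two_values_le: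
  assumes U: "finite U" and "a \<in> U" "b \<in> U" "a \<noteq> b" "a' \<in> U" "b' \<in> U" "a' \<noteq> b'"
  shows "card {x. x permutes U \<and> x i = a \<and> x j = b} \<le> card {x. x permutes U \<and> x i = a' \<and> x j = b'}"
proof -
  \<comment> \<open>Send \<open>a\<close> to \<open>a'\<close>, then move the image of
    \<open>b\<close> to \<open>b'\<close>; the second swap fixes \<open>a'\<close>, which differs
    from both of its points. Left multiplication by \<open>g\<close> is the required
    injection.\<close>
  define g where "g = transpose (transpose a a' b) b' \<circ> transpose a a'"
  have "transpose a a' b \<in> U" using assms by (auto simp: transpose_def)
  then have gU: "g permutes U"
    unfolding g_def using assms by (intro permutes_compose permutes_swap_id)
  have ga: "g a = a'" and gb: "g b = b'"
    using assms by (auto simp: g_def transpose_def)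
  have "inj_on ((\<circ>) g) {x. x permutes U \<and> x i = a \<and> x j = b}"
    by (rule inj_on_inverseI[where g = "(\<circ>) (inv' g)"])
      (simp add: permutes_inv_o(2)[OF gU] flip: comp_assoc)
  moreover have "(\<circ>) g ` {x. x permutes U \<and> x i = a \<and> x j = b}
      \<subseteq> {x. x permutes U \<and> x i = a' \<and> x j = b'}"
    using ga gb permutes_compose[OF _ gU] by auto
  moreover have "finite {x. x permutes U \<and> x i = a' \<and> x j = b'}"
    using finite_permutations[OF U] by (rule finite_subset[rotated]) auto
  ultimately show ?thesis by (rule card_inj_on_le)
qed

text \<open>The fibres over distinct pairs are all equinumerous, by the preceding inequality in both
  directions; the fibre over \<open>(i, j)\<close> serves as reference.\<close>

lemma card_permutes_two_values_in:
  assumes U: "finite U" and P: "P \<subseteq> U \<times> U" "\<And>a b. (a, b) \<in> P \<Longrightarrow> a \<noteq> b"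
    and ij: "i \<in> U" "j \<in> U" "i \<noteq> j"
  shows "card {x. x permutes U \<and> (x i, x j) \<in> P} = card P * card {x. x permutes U \<and> x i = i \<and> x j = j}"
proof -
  let ?F = "\<lambda>p. {x. x permutes U \<and> x i = fst p \<and> x j = snd p}"
  have fF: "finite (?F p)" for p
    using finite_permutations[OF U] by (rule finite_subset[rotated]) auto
  have fP: "finite P" using P(1) U finite_subset by blast
  have "card (?F p) = card {x. x permutes U \<and> x i = i \<and> x j = j}" if "p \<in> P" for p
    using that P ij by (intro antisym card_permutes_two_values_le U) force+
  moreover have "{x. x permutes U \<and> (x i, x j) \<in> P} = (\<Union>p\<in>P. ?F p)" by auto
  moreover have "card (\<Union>p\<in>P. ?F p) = (\<Sum>p\<in>P. card (?F p))"
    using fF fP by (intro card_UN_disjoint) auto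
  ultimately show ?thesis by simp
qed

text \<open>For \<open>m < n\<close> the condition says \<open>(b - a) mod n \<in> {1..m}\<close>.\<close>

definition arc_pairs :: "nat \<Rightarrow> nat \<Rightarrow> (nat \<times> nat) set" where
  "arc_pairs n m = {(a, b). a \<in> {1..n} \<and> b \<in> {1..n} \<and> (a < b \<and> b \<le> a + m \<or> b < a \<and> b + n \<le> a + m)}"

lemma card_arc_pairs:
  assumes "m < n"
  shows "card (arc_pairs n m) = n * m"
proof -
  \<comment> \<open>The second interval is the part that wraps past \<open>n\<close>, empty by
    truncated subtraction when \<open>a + m \<le> n\<close>. It stays below \<open>a\<close> because
    \<open>m < n\<close>, so the union is disjoint.\<close>
  have "arc_pairs n m = (SIGMA a:{1..n}. {a<..min n (a + m)} \<union> {1..a + m - n})"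
    using assms by (auto simp: arc_pairs_def)
  moreover have "card ({a<..min n (a + m)} \<union> {1..a + m - n}) = m" if "a \<in> {1..n}" for a
    using that assms by (subst card_Un_disjoint) auto
  ultimately show ?thesis by simp
qed

lemma long_cycle_arc_pairs:
  assumes "m < n" "a \<in> {1..n}" "b \<in> {1..n}"
  shows "(long_cycle n a, long_cycle n b) \<in> arc_pairs n m \<longleftrightarrow> (a, b) \<in> arc_pairs n m"
  using assms by (auto simp: arc_pairs_def long_cycle_apply)

text \<open>If just one entry is 1 or 2, the swap changes the forward distance by one, and only an
  increase from \<open>m\<close> to \<open>m + 1\<close> leaves the arc. The pair (1, 2) is
  reversed, while (2, 1) has distance \<open>n - 1 > m\<close>.\<close>

lemma transpose_leaves_arc_pairs:
  assumes "2 * m < n" "(a, b) \<in> arc_pairs n m" "(transpose 1 2 a, transpose 1 2 b) \<notin> arc_pairs n m"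
  shows "(a, b) \<in> {(1, 2), (2, m + 2), (n + 1 - m, 1)}"
  using assms by (auto simp: arc_pairs_def transpose_def split: if_splits)

section \<open>The upper bound on the Cheeger constant\<close>

lemma cheeger_constant_le:
  assumes "finite V" "A \<subseteq> V" "0 < card A" "real (card A) \<le> real (card V) / 2"
  shows "cheeger_constant V E \<le> real (card (edge_boundary V E A)) / real (card A)"
proof -
  have "finite {A. A \<subseteq> V \<and> 0 < card A \<and> real (card A) \<le> real (card V) / 2}"
    using assms(1) by (rule finite_subset[rotated, OF finite_Pow_iff[THEN iffD2]]) auto
  then show ?thesis
    unfolding cheeger_constant_def using assms by (intro Min_le finite_imageI imageI) auto
qed

lemma cheeger_constant_sym_group_le:
  assumes n: "n \<ge> 3"
  shows "cheeger_constant (carrier (sym_group n)) (cayley_edges (sym_group n) (sym_generators n))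
    \<le> 12 / real n ^ 2"
proof -
  \<comment> \<open>As large as \<open>2 * m < n\<close> allows, which keeps \<open>A\<close> within
    half the group; \<open>n \<le> 4 * m\<close> later turns 3 / (n m) into 12 / n^2.\<close>
  define m where "m = (n - 1) div 2"
  define U V E where "U = {1..n}" and "V = carrier (sym_group n)"
    and "E = cayley_edges (sym_group n) (sym_generators n)"
  have m: "2 * m < n" "n \<le> 4 * m" "m < n" using n unfolding m_def by presburger+
  have VU: "V = {x. x permutes U}" by (simp add: V_def U_def carrier_sym_group)
  have fV: "finite V" unfolding V_def by (rule finite_carrier_sym_group)
  have fU: "finite U" and U12: "1 \<in> U" "2 \<in> U" using n by (auto simp: U_def)
  define A where "A = {x. x permutes U \<and> (x 1, x 2) \<in> arc_pairs n m}"
  \<comment> \<open>The common fibre size, which cancels from the ratio of boundary to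
    volume.\<close>
  define N where "N = card {x. x permutes U \<and> x 1 = 1 \<and> x 2 = 2}"
  define B where "B = {(1, 2), (2, m + 2), (n + 1 - m, 1)}"
  have cardA: "card A = n * m * N"
    unfolding A_def N_def card_arc_pairs[OF m(3), symmetric] using fU U12
    by (intro card_permutes_two_values_in) (auto simp: arc_pairs_def U_def)
  have "finite {x. x permutes U \<and> x 1 = 1 \<and> x 2 = 2}"
    using finite_permutations[OF fU] by (rule finite_subset[rotated]) auto
  moreover have "id \<in> {x. x permutes U \<and> x 1 = 1 \<and> x 2 = 2}"
    by (simp add: permutes_id)
  ultimately have N0: "N > 0"
    unfolding N_def card_gt_0_iff by blast
  have A0: "card A > 0" using N0 m n by (simp add: cardA)
  have AV: "A \<subseteq> V" by (auto simp: A_def VU)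
  \<comment> \<open>Exchanging the two cards maps \<open>A\<close> injectively outside itself: the
    two forward distances add up to \<open>n\<close>, so they cannot both be at most
    \<open>m\<close>.\<close>
  have half: "real (card A) \<le> real (card V) / 2"
  proof -
    let ?r = "\<lambda>x. x \<circ> transpose (1::nat) 2"
    have t: "transpose 1 2 permutes U" using U12 by (intro permutes_swap_id)
    have "inj_on ?r A"
      by (rule inj_on_inverseI[where g = ?r]) (simp add: comp_assoc)
    then have "card (?r ` A) = card A" by (rule card_image)
    moreover have "?r ` A \<inter> A = {}"
      using m by (auto simp: A_def arc_pairs_def)
    moreover have "?r ` A \<subseteq> V"
      using permutes_compose[OF t] by (auto simp: A_def VU)
    ultimately have "card A + card A \<le> card V"
      using AV fV card_mono[of V "?r ` A \<union> A"] finite_subset[OF AV fV]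
      by (simp add: card_Un_disjoint)
    then show ?thesis by simp
  qed
  have rot: "long_cycle n \<circ> x \<in> A \<longleftrightarrow> x \<in> A" if x: "x permutes U" for x
    using long_cycle_arc_pairs[OF m(3), of "x 1" "x 2"] permutes_in_image[OF x] U12
      x permutes_compose[OF x, of "long_cycle n"] long_cycle_permutes[of n]
    by (simp add: A_def U_def)
  have rot': "inv' (long_cycle n) \<circ> x \<in> A \<longleftrightarrow> x \<in> A" if x: "x permutes U" for x
  proof -
    have c: "long_cycle n permutes U" using long_cycle_permutes by (simp add: U_def)
    have "long_cycle n \<circ> (inv' (long_cycle n) \<circ> x) = x"
      by (simp add: permutes_inv_o(1)[OF c] flip: comp_assoc)
    then show ?thesis using rot[OF permutes_compose[OF x permutes_inv[OF c]]] by simp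
  qed
  let ?D = "{x \<in> A. transpose 1 2 \<circ> x \<notin> A}"
  \<comment> \<open>Rotations preserve \<open>A\<close>, so a boundary edge comes from (1 2); as
    this is an involution, the endpoint in \<open>A\<close> determines the edge.\<close>
  have bd: "edge_boundary V E A \<subseteq> (\<lambda>x. {x, transpose 1 2 \<circ> x}) ` ?D"
  proof
    fix e assume "e \<in> edge_boundary V E A"
    then obtain x y z s where xy: "x \<in> A" "y \<in> V" "y \<notin> A" "e = {x, y}"
      and zs: "z permutes U" "s \<in> sym_generators n" "e = {z, s \<circ> z}"
      unfolding edge_boundary_def E_def cayley_edges_def
      by (auto simp: sym_group_carrier sym_group_mult U_def)
    have "x = z \<and> y = s \<circ> z \<or> x = s \<circ> z \<and> y = z"
      using xy zs by (auto simp: doubleton_eq_iff)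
    then have "s = transpose 1 2"
      using xy zs rot[OF zs(1)] rot'[OF zs(1)] by (auto simp: sym_generators_eq)
    then have "y = transpose 1 2 \<circ> x"
      using \<open>x = z \<and> y = s \<circ> z \<or> x = s \<circ> z \<and> y = z\<close> by (auto simp flip: comp_assoc)
    then show "e \<in> (\<lambda>x. {x, transpose 1 2 \<circ> x}) ` ?D" using xy by blast
  qed
  \<comment> \<open>Intersecting with \<open>arc_pairs\<close> guarantees distinct entries in
    \<open>U\<close>, as the counting lemma requires.\<close>
  have "?D \<subseteq> {x. x permutes U \<and> (x 1, x 2) \<in> B \<inter> arc_pairs n m}"
    using transpose_leaves_arc_pairs[OF m(1)] permutes_compose[of _ U "transpose 1 2"]
      permutes_swap_id[OF U12] by (auto simp: A_def B_def)
  moreover have "card {x. x permutes U \<and> (x 1, x 2) \<in> B \<inter> arc_pairs n m} = card (B \<inter> arc_pairs n m) * N"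
    unfolding N_def using fU U12
    by (intro card_permutes_two_values_in) (auto simp: arc_pairs_def U_def)
  moreover have "finite {x. x permutes U \<and> (x 1, x 2) \<in> B \<inter> arc_pairs n m}"
    using finite_permutations[OF fU] by (rule finite_subset[rotated]) auto
  ultimately have "card ?D \<le> card (B \<inter> arc_pairs n m) * N" using card_mono by fastforce
  also have "card (B \<inter> arc_pairs n m) \<le> card B"
    by (rule card_mono) (auto simp: B_def)
  also have "card B \<le> 3" by (simp add: B_def card_insert_le_m1)
  finally have D: "card ?D \<le> 3 * N" by simp
  have "finite ?D" using AV fV finite_subset by fastforce
  then have bdN: "card (edge_boundary V E A) \<le> 3 * N"
    using surj_card_le[OF _ bd] D by linarith
  have "cheeger_constant V E \<le> real (card (edge_boundary V E A)) / real (card A)"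
    by (rule cheeger_constant_le[OF fV AV A0 half])
  also have "\<dots> \<le> real (3 * N) / real (n * m * N)"
    unfolding cardA by (rule divide_right_mono[OF of_nat_mono[OF bdN]]) simp
  also have "\<dots> = 3 / (n * m)" using N0 by simp
  also have "\<dots> \<le> 12 / real n ^ 2"
  proof -
    have "real n * real n \<le> real n * (4 * real m)" using m(2) by (intro mult_left_mono) auto
    then show ?thesis using n m by (simp add: field_simps power2_eq_square)
  qed
  finally show ?thesis by (simp add: V_def E_def)
qed

theorem theorem6:
  "\<exists>c1 c2 :: real. c1 > 0 \<and> c2 > 0 \<and>
     (\<forall>n\<ge>3.
        cheeger_constant (carrier (sym_group n)) (cayley_edges (sym_group n) (sym_generators n))
          \<le> c1 / real n ^ 2 \<and>
        spectral_gap (carrier (sym_group n)) (cayley_edges (sym_group n) (sym_generators n))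
          \<ge> c2 / real n ^ 3)"
proof (intro exI conjI allI impI)
  fix n :: nat assume n: "n \<ge> 3"
  show "cheeger_constant (carrier (sym_group n)) (cayley_edges (sym_group n) (sym_generators n))
      \<le> 12 / real n ^ 2"
    using n by (rule cheeger_constant_sym_group_le)
  show "spectral_gap (carrier (sym_group n)) (cayley_edges (sym_group n) (sym_generators n))
      \<ge> (1 / 72) / real n ^ 3"
    using n by (intro spectral_gap_sym_group_ge) simp
qed simp_all

end
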